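(* Fix a feedback policy $u^\psi$ and denote its value function by $v^\psi$. Suppose $v^\psi\in C^{1,2}([0,T]\times\mathbb{R}^{D_x})$ and that there exists a unique strong solution $\{X_t,0\le t\le T\}$ to the forward SDE $$dX_t=\bigl(F(t,X_t)+G(t,X_t)u^\psi(t,X_t)\bigr)\,dt+\sigma(t,X_t)\,dW_t,\qquad X_0=x_0 .$$ Let $\{z^\theta:\theta\in\Theta\}$ be a family of functions $z^\theta:[0,T]\times\mathbb{R}^{D_x}\to\mathbb{R}^{D_w}$, indexed by an abstract set $\Theta$, with $\{z^\theta(t,X_t):0\le t\le T\}\in\mathscr{L}^2_{\mathcal F}([0,T])$ for each $\theta$. For $\theta\in\Theta$ and $y_0^{DB}\in\mathbb{R}$ define $$y^\theta_t := \phi(X_T) + \int_t^T g^\psi(\tau,X_\tau)\,d\tau - \int_t^T\langle z^\theta(\tau, X_\tau), dW_\tau\rangle ,$$ $$y_t^{\theta,DB} := y_0^{DB}-\int_0^t g^\psi(\tau,X_\tau)\,d\tau+\int_0^t\langle z^\theta(\tau,X_\tau),dW_\tau\rangle ,$$ where $\theta$ and $y_0^{DB}$ are variables to be optimized. Then $$\min_{\theta,\,y_0^{DB}}\mathbb{E}\bigl|y_T^{\theta,DB}-\phi(X_T)\bigr|^2=\min_{\theta}\mathbb{E}\bigl|y_0^\theta-\mathbb{E}\,y_0^\theta\bigr|^2 .$$ Moreover, if the left-hand side optimization problem attains its minimum at $(y_0^{*,DB},\theta^* )$, then the right-hand side also attains its minimum at $\theta^*$. Conversely, if the right-hand side attains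 its minimum at $\theta^*$, then there exists $y_0^{*,DB}\in\mathbb{R}$ such that the left-hand side optimization problem attains its minimum at $(y_0^{*,DB},\theta^* )$.
   Context: Setting. $0<T<\infty$; $(\Omega,\mathcal F,\{\mathcal F_t\}_{0\le t\le T},\mathbb P)$ is a filtered probability space satisfying the usual conditions, $W$ is a standard $\mathbb{R}^{D_w}$-valued Brownian motion, $\{\mathcal F_t\}$ is the natural filtration generated by $W$, with $\mathcal F_0$ containing all $\mathbb P$-null sets. The initial state $x_0\in\mathbb{R}^{D_x}$ is deterministic. The data are functions $F:[0,T]\times\mathbb{R}^{D_x}\to\mathbb{R}^{D_x}$, $G:[0,T]\times\mathbb{R}^{D_x}\to\mathbb{R}^{D_x\times D_u}$, $\sigma:[0,T]\times\mathbb{R}^{D_x}\to\mathbb{R}^{D_x\times D_w}$ (independent of the control), $Q:[0,T]\times\mathbb{R}^{D_x}\to\mathbb{R}$, $\phi:\mathbb{R}^{D_x}\to\mathbb{R}$, and $R(t,x)$, a positive definite $D_u\times D_u$ matrix depending on $(t,x)$. A feedback policy is a function $u^\psi:[0,T]\times\mathbb{R}^{D_x}\to\mathbb{R}^{D_u}$. Its running cost is $g^\psi(t,x):=Q(t,x)+\frac12\langle R(t,x)u^\psi(t,x),u^\psi(t,x)\rangle$. Its value function is $$v^\psi(t,x):=\mathbb{E}\Bigl[\phi(X_T)+\int_t^T g^\psi(\tau,X_\tau)\,d\tau\Bigm|X_t=x\Bigr],$$ where $\{X_\tau,t\le\tau\le T\}$ solves $dX_\tau=(F(\tau,X_\tau)+G(\tau,X_\tau)u^\psi(\tau,X_\tau))\,d\tau+\sigma(\tau,X_\tau)\,dW_\tau$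 started from $X_t=x$. Throughout, the value function of a policy is taken to satisfy the linear PDE $$\mathcal L^\psi v^\psi(t,x)+g^\psi(t,x)=0,\qquad v^\psi(T,x)=\phi(x),$$ $$\mathcal L^\psi v(t,x):=v_t(t,x)+\langle v_x(t,x),F(t,x)+G(t,x)u^\psi(t,x)\rangle+\tfrac12\operatorname{tr}\{v_{xx}(t,x)\sigma\sigma^\intercal(t,x)\}.$$ Consequently the backward equation $dY_t=-g^\psi(t,X_t)\,dt+\langle Z_t,dW_t\rangle$, $Y_T=\phi(X_T)$, is represented by the adapted solution $Y_t=v^\psi(t,X_t)$, $Z_t=\sigma(t,X_t)^\intercal v^\psi_x(t,X_t)$. Notation. $v\in C^{1,2}([0,T]\times\mathbb{R}^{D_x})$ means $v_t,v_x,v_{xx}$ are continuous on the interior of the domain; $v_x$ is the gradient in $x$. $\mathscr{L}^2_{\mathcal F}([0,T])$ is the set of all $\{\mathcal F_t\}$-adapted processes $\{\xi_t,0\le t\le T\}$ with $\mathbb{E}\int_0^T\|\xi_t\|^2\,dt<\infty$. *)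

theory Defs
  imports "HOL-Probability.Probability"
begin

section \<open>Brownian motion and its augmented filtration\<close>

definition augmented_filtration ::
    "'a measure \<Rightarrow> (real \<Rightarrow> 'a \<Rightarrow> real ^ 'w) \<Rightarrow> real \<Rightarrow> 'a measure" where
  "augmented_filtration M W t =
     sigma (space M)
       (null_sets M \<union> {W s -` A \<inter> space M | s A. 0 \<le> s \<and> s \<le> t \<and> A \<in> sets borel})"

text \<open>
  Only the restriction of \<open>Fil\<close> and \<open>W\<close> to the time interval \<open>[0, T]\<close> matters. The increment
  over \<open>[s, t]\<close> has the density of the Gaussian law with mean \<open>0\<close> and covariance \<open>(t - s) I\<close>;
  \<open>normal_density\<close> is parametrised by the standard deviation. The usual conditions are
  completeness, \<open>null_sets\<close> and \<open>right_continuous\<close>; for the augmented filtration of a Brownian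
  motion the last two are redundant.
\<close>

locale brownian_basis = prob_space M + complete_measure M
  for M :: "'a measure" +
  fixes Fil :: "real \<Rightarrow> 'a measure"
    and W :: "real \<Rightarrow> 'a \<Rightarrow> real ^ 'w"
    and T :: real
  assumes T_pos: "0 < T"
    and W_measurable: "\<And>t. t \<in> {0..T} \<Longrightarrow> W t \<in> borel_measurable M"
    and natural: "\<And>t. t \<in> {0..T} \<Longrightarrow> sets (Fil t) = sets (augmented_filtration M W t)"
    and null_sets: "null_sets M \<subseteq> sets (Fil 0)"
    and right_continuous: "\<And>t. t \<in> {0..<T} \<Longrightarrow> sets (Fil t) = (\<Inter>r\<in>{t<..T}. sets (Fil r))"
    and W_start: "AE \<omega> in M. W 0 \<omega> = 0"
    and W_continuous: "AE \<omega> in M. continuous_on {0..T} (\<lambda>t. W t \<omega>)"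
    and W_independent: "\<And>s t. 0 \<le> s \<Longrightarrow> s < t \<Longrightarrow> t \<le> T \<Longrightarrow>
          indep_set (sets (Fil s)) {(\<lambda>\<omega>. W t \<omega> - W s \<omega>) -` A \<inter> space M | A. A \<in> sets borel}"
    and W_gaussian: "\<And>s t. 0 \<le> s \<Longrightarrow> s < t \<Longrightarrow> t \<le> T \<Longrightarrow>
          distributed M lborel (\<lambda>\<omega>. W t \<omega> - W s \<omega>)
            (\<lambda>x. ennreal (\<Prod>i\<in>UNIV. normal_density 0 (sqrt (t - s)) (x $ i)))"


section \<open>Stochastic integrals\<close>

definition measurable_adapted ::
    "'a measure \<Rightarrow> (real \<Rightarrow> 'a measure) \<Rightarrow> real \<Rightarrow> real \<Rightarrow>
     (real \<Rightarrow> 'a \<Rightarrow> 'b::topological_space) \<Rightarrow> bool" where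
  "measurable_adapted M Fil s T \<xi> \<longleftrightarrow>
     (\<lambda>(t, \<omega>). \<xi> t \<omega>) \<in> borel_measurable (restrict_space borel {s..T} \<Otimes>\<^sub>M M) \<and>
     (\<forall>t\<in>{s..T}. \<xi> t \<in> borel_measurable (Fil t))"

definition L2_process ::
    "'a measure \<Rightarrow> (real \<Rightarrow> 'a measure) \<Rightarrow> real \<Rightarrow> (real \<Rightarrow> 'a \<Rightarrow> real ^ 'w) \<Rightarrow> bool" where
  "L2_process M Fil T \<xi> \<longleftrightarrow>
     measurable_adapted M Fil 0 T \<xi> \<and>
     (\<integral>\<^sup>+\<omega>. (\<integral>\<^sup>+t\<in>{0..T}. ennreal ((norm (\<xi> t \<omega>))\<^sup>2) \<partial>lborel) \<partial>M) < \<infinity>"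

text \<open>
  A simple integrand on \<open>[s, T]\<close> is given by a partition \<open>\<tau> 0 < \<dots> < \<tau> n\<close> of the interval and
  bounded random variables \<open>\<eta> i\<close>, known at time \<open>\<tau> i\<close> and used on \<open>(\<tau> i, \<tau> (i + 1)]\<close>.
\<close>

definition simple_integrand ::
    "'a measure \<Rightarrow> (real \<Rightarrow> 'a measure) \<Rightarrow> real \<Rightarrow> real \<Rightarrow>
     nat \<Rightarrow> (nat \<Rightarrow> real) \<Rightarrow> (nat \<Rightarrow> 'a \<Rightarrow> real ^ 'w) \<Rightarrow> bool" where
  "simple_integrand M Fil s T n \<tau> \<eta> \<longleftrightarrow>
     \<tau> 0 = s \<and> \<tau> n = T \<and>
     (\<forall>i<n. \<tau> i < \<tau> (Suc i) \<and> \<eta> i \<in> borel_measurable (Fil (\<tau> i)) \<and>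
        (\<exists>C. \<forall>\<omega>\<in>space M. norm (\<eta> i \<omega>) \<le> C))"

definition simple_process ::
    "nat \<Rightarrow> (nat \<Rightarrow> real) \<Rightarrow> (nat \<Rightarrow> 'a \<Rightarrow> real ^ 'w) \<Rightarrow> real \<Rightarrow> 'a \<Rightarrow> real ^ 'w" where
  "simple_process n \<tau> \<eta> t \<omega> = (\<Sum>i<n. indicator {\<tau> i<..\<tau> (Suc i)} t *\<^sub>R \<eta> i \<omega>)"

definition simple_integral ::
    "(real \<Rightarrow> 'a \<Rightarrow> real ^ 'w) \<Rightarrow> nat \<Rightarrow> (nat \<Rightarrow> real) \<Rightarrow> (nat \<Rightarrow> 'a \<Rightarrow> real ^ 'w) \<Rightarrow>
     real \<Rightarrow> 'a \<Rightarrow> real" where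
  "simple_integral W n \<tau> \<eta> t \<omega> =
     (\<Sum>i<n. inner (\<eta> i \<omega>) (W (min t (\<tau> (Suc i))) \<omega> - W (min t (\<tau> i)) \<omega>))"

definition vanishes_in_prob :: "'a measure \<Rightarrow> (nat \<Rightarrow> 'a \<Rightarrow> ennreal) \<Rightarrow> bool" where
  "vanishes_in_prob M D \<longleftrightarrow>
     (\<forall>\<epsilon>>0. (\<lambda>k. measure M {\<omega> \<in> space M. ennreal \<epsilon> < D k \<omega>}) \<longlonglongrightarrow> 0)"

text \<open>
  \<open>has_ito_integral M Fil W s T \<xi> I\<close>: the continuous adapted process \<open>I\<close> is (a version of)
  \<open>I t = \<integral>\<^sub>s\<^sup>t \<langle>\<xi> r, dW r\<rangle>\<close> for \<open>s \<le> t \<le> T\<close>. This is the extension by limits in probability, which covers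
  all integrands with almost surely square integrable paths (as required for the diffusion term
  of an equation); on integrands with finite \<open>E \<integral> |\<xi>|\<^sup>2\<close> it agrees with the \<open>L\<^sup>2\<close> construction.
  The limit is unique up to indistinguishability.
\<close>

definition has_ito_integral ::
    "'a measure \<Rightarrow> (real \<Rightarrow> 'a measure) \<Rightarrow> (real \<Rightarrow> 'a \<Rightarrow> real ^ 'w) \<Rightarrow> real \<Rightarrow> real \<Rightarrow>
     (real \<Rightarrow> 'a \<Rightarrow> real ^ 'w) \<Rightarrow> (real \<Rightarrow> 'a \<Rightarrow> real) \<Rightarrow> bool" where
  "has_ito_integral M Fil W s T \<xi> I \<longleftrightarrow>
     measurable_adapted M Fil s T \<xi> \<and>
     (AE \<omega> in M. (\<integral>\<^sup>+t\<in>{s..T}. ennreal ((norm (\<xi> t \<omega>))\<^sup>2) \<partial>lborel) < \<infinity>) \<and>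
     (\<forall>t\<in>{s..T}. I t \<in> borel_measurable (Fil t)) \<and>
     (AE \<omega> in M. continuous_on {s..T} (\<lambda>t. I t \<omega>)) \<and>
     (\<exists>n \<tau> \<eta>.
        (\<forall>k. simple_integrand M Fil s T (n k) (\<tau> k) (\<eta> k)) \<and>
        vanishes_in_prob M (\<lambda>k \<omega>. \<integral>\<^sup>+t\<in>{s..T}.
          ennreal ((norm (simple_process (n k) (\<tau> k) (\<eta> k) t \<omega> - \<xi> t \<omega>))\<^sup>2) \<partial>lborel) \<and>
        (\<forall>t\<in>{s..T}. vanishes_in_prob M (\<lambda>k \<omega>.
          ennreal \<bar>simple_integral W (n k) (\<tau> k) (\<eta> k) t \<omega> - I t \<omega>\<bar>)))"

text \<open>
  As for other integrals, the operator picks a version if there is one, and is \<open>0\<close> otherwise. The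
  integral exists for every integrand satisfying \<open>L2_process\<close>.
\<close>

definition ito_integral ::
    "'a measure \<Rightarrow> (real \<Rightarrow> 'a measure) \<Rightarrow> (real \<Rightarrow> 'a \<Rightarrow> real ^ 'w) \<Rightarrow> real \<Rightarrow> real \<Rightarrow>
     (real \<Rightarrow> 'a \<Rightarrow> real ^ 'w) \<Rightarrow> real \<Rightarrow> 'a \<Rightarrow> real" where
  "ito_integral M Fil W s T \<xi> =
     (if \<exists>I. has_ito_integral M Fil W s T \<xi> I
      then SOME I. has_ito_integral M Fil W s T \<xi> I else (\<lambda>t \<omega>. 0))"


section \<open>Stochastic differential equations\<close>

text \<open>
  Solutions of \<open>dX t = b t (X t) dt + S t (X t) dW t\<close> on \<open>[s, T]\<close> with \<open>X s = x\<close>. They are adapted to the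
  given filtration, hence strong when it is the augmented filtration of \<open>W\<close>. The \<open>i\<close>-th component
  of the matrix-valued stochastic integral is the integral of the \<open>i\<close>-th row of \<open>S\<close>.
\<close>

definition sde_solution ::
    "'a measure \<Rightarrow> (real \<Rightarrow> 'a measure) \<Rightarrow> (real \<Rightarrow> 'a \<Rightarrow> real ^ 'w) \<Rightarrow> real \<Rightarrow>
     (real \<Rightarrow> real ^ 'x \<Rightarrow> real ^ 'x) \<Rightarrow> (real \<Rightarrow> real ^ 'x \<Rightarrow> real ^ 'w ^ 'x) \<Rightarrow>
     real \<Rightarrow> real ^ 'x \<Rightarrow> (real \<Rightarrow> 'a \<Rightarrow> real ^ 'x) \<Rightarrow> bool" where
  "sde_solution M Fil W T b S s x X \<longleftrightarrow>
     (\<forall>t\<in>{s..T}. X t \<in> borel_measurable (Fil t)) \<and>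
     (AE \<omega> in M. continuous_on {s..T} (\<lambda>t. X t \<omega>)) \<and>
     (AE \<omega> in M. set_integrable lborel {s..T} (\<lambda>t. b t (X t \<omega>))) \<and>
     (\<exists>I :: real \<Rightarrow> 'a \<Rightarrow> real ^ 'x.
        (\<forall>i. has_ito_integral M Fil W s T (\<lambda>t \<omega>. S t (X t \<omega>) $ i) (\<lambda>t \<omega>. I t \<omega> $ i)) \<and>
        (AE \<omega> in M. \<forall>t\<in>{s..T}. X t \<omega> = x + (LINT r:{s..t}|lborel. b r (X r \<omega>)) + I t \<omega>))"

definition unique_strong_solution ::
    "'a measure \<Rightarrow> (real \<Rightarrow> 'a measure) \<Rightarrow> (real \<Rightarrow> 'a \<Rightarrow> real ^ 'w) \<Rightarrow> real \<Rightarrow>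
     (real \<Rightarrow> real ^ 'x \<Rightarrow> real ^ 'x) \<Rightarrow> (real \<Rightarrow> real ^ 'x \<Rightarrow> real ^ 'w ^ 'x) \<Rightarrow>
     real \<Rightarrow> real ^ 'x \<Rightarrow> (real \<Rightarrow> 'a \<Rightarrow> real ^ 'x) \<Rightarrow> bool" where
  "unique_strong_solution M Fil W T b S s x X \<longleftrightarrow>
     sde_solution M Fil W T b S s x X \<and>
     (\<forall>X'. sde_solution M Fil W T b S s x X' \<longrightarrow>
        (AE \<omega> in M. \<forall>t\<in>{s..T}. X' t \<omega> = X t \<omega>))"


section \<open>The control problem\<close>

definition positive_definite :: "real ^ 'n ^ 'n \<Rightarrow> bool" where
  "positive_definite A \<longleftrightarrow> transpose A = A \<and> (\<forall>v. v \<noteq> 0 \<longrightarrow> 0 < inner (A *v v) v)"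

definition running_cost ::
    "(real \<Rightarrow> real ^ 'x \<Rightarrow> real) \<Rightarrow> (real \<Rightarrow> real ^ 'x \<Rightarrow> real ^ 'u ^ 'u) \<Rightarrow>
     (real \<Rightarrow> real ^ 'x \<Rightarrow> real ^ 'u) \<Rightarrow> real \<Rightarrow> real ^ 'x \<Rightarrow> real" where
  "running_cost Q R u t x = Q t x + 1 / 2 * inner (R t x *v u t x) (u t x)"

definition controlled_drift ::
    "(real \<Rightarrow> real ^ 'x \<Rightarrow> real ^ 'x) \<Rightarrow> (real \<Rightarrow> real ^ 'x \<Rightarrow> real ^ 'u ^ 'x) \<Rightarrow>
     (real \<Rightarrow> real ^ 'x \<Rightarrow> real ^ 'u) \<Rightarrow> real \<Rightarrow> real ^ 'x \<Rightarrow> real ^ 'x" where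
  "controlled_drift F G u t x = F t x + G t x *v u t x"

text \<open>
  Conditioning on \<open>X t = x\<close> means that the equation is started from \<open>x\<close> at time \<open>t\<close>. The value is
  well defined: there is a solution, and the cost of any solution is integrable with mean \<open>v t x\<close>.
\<close>

definition is_value_function ::
    "'a measure \<Rightarrow> (real \<Rightarrow> 'a measure) \<Rightarrow> (real \<Rightarrow> 'a \<Rightarrow> real ^ 'w) \<Rightarrow> real \<Rightarrow>
     (real \<Rightarrow> real ^ 'x \<Rightarrow> real ^ 'x) \<Rightarrow> (real \<Rightarrow> real ^ 'x \<Rightarrow> real ^ 'w ^ 'x) \<Rightarrow>
     (real \<Rightarrow> real ^ 'x \<Rightarrow> real) \<Rightarrow> (real ^ 'x \<Rightarrow> real) \<Rightarrow>
     (real \<Rightarrow> real ^ 'x \<Rightarrow> real) \<Rightarrow> bool" where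
  "is_value_function M Fil W T b S g \<phi> v \<longleftrightarrow>
     (\<forall>t\<in>{0..T}. \<forall>x.
        (\<exists>X. sde_solution M Fil W T b S t x X) \<and>
        (\<forall>X. sde_solution M Fil W T b S t x X \<longrightarrow>
           (AE \<omega> in M. set_integrable lborel {t..T} (\<lambda>r. g r (X r \<omega>))) \<and>
           integrable M (\<lambda>\<omega>. \<phi> (X T \<omega>) + (LINT r:{t..T}|lborel. g r (X r \<omega>))) \<and>
           v t x = prob_space.expectation M
             (\<lambda>\<omega>. \<phi> (X T \<omega>) + (LINT r:{t..T}|lborel. g r (X r \<omega>)))))"

definition time_deriv :: "(real \<Rightarrow> real ^ 'x \<Rightarrow> real) \<Rightarrow> real \<Rightarrow> real ^ 'x \<Rightarrow> real" where
  "time_deriv v t x = deriv (\<lambda>s. v s x) t"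

definition space_grad :: "(real \<Rightarrow> real ^ 'x \<Rightarrow> real) \<Rightarrow> real \<Rightarrow> real ^ 'x \<Rightarrow> real ^ 'x" where
  "space_grad v t x = (\<chi> i. frechet_derivative (v t) (at x) (axis i 1))"

definition space_hess :: "(real \<Rightarrow> real ^ 'x \<Rightarrow> real) \<Rightarrow> real \<Rightarrow> real ^ 'x \<Rightarrow> real ^ 'x ^ 'x" where
  "space_hess v t x = jacobian (space_grad v t) (at x)"

definition C12 :: "real \<Rightarrow> (real \<Rightarrow> real ^ 'x \<Rightarrow> real) \<Rightarrow> bool" where
  "C12 T v \<longleftrightarrow>
     (\<forall>t\<in>{0<..<T}. \<forall>x. (\<lambda>s. v s x) differentiable (at t) \<and> v t differentiable (at x) \<and>
        space_grad v t differentiable (at x)) \<and>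
     continuous_on ({0<..<T} \<times> UNIV) (\<lambda>(t, x). time_deriv v t x) \<and>
     continuous_on ({0<..<T} \<times> UNIV) (\<lambda>(t, x). space_grad v t x) \<and>
     continuous_on ({0<..<T} \<times> UNIV) (\<lambda>(t, x). space_hess v t x)"

definition generator ::
    "(real \<Rightarrow> real ^ 'x \<Rightarrow> real ^ 'x) \<Rightarrow> (real \<Rightarrow> real ^ 'x \<Rightarrow> real ^ 'w ^ 'x) \<Rightarrow>
     (real \<Rightarrow> real ^ 'x \<Rightarrow> real) \<Rightarrow> real \<Rightarrow> real ^ 'x \<Rightarrow> real" where
  "generator b S v t x =
     time_deriv v t x + inner (space_grad v t x) (b t x) +
     1 / 2 * trace (space_hess v t x ** (S t x ** transpose (S t x)))"

definition satisfies_value_pde ::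
    "real \<Rightarrow> (real \<Rightarrow> real ^ 'x \<Rightarrow> real ^ 'x) \<Rightarrow> (real \<Rightarrow> real ^ 'x \<Rightarrow> real ^ 'w ^ 'x) \<Rightarrow>
     (real \<Rightarrow> real ^ 'x \<Rightarrow> real) \<Rightarrow> (real ^ 'x \<Rightarrow> real) \<Rightarrow>
     (real \<Rightarrow> real ^ 'x \<Rightarrow> real) \<Rightarrow> bool" where
  "satisfies_value_pde T b S g \<phi> v \<longleftrightarrow>
     (\<forall>t\<in>{0<..<T}. \<forall>x. generator b S v t x + g t x = 0) \<and> (\<forall>x. v T x = \<phi> x)"


section \<open>The two optimization problems\<close>

definition y_proc ::
    "'a measure \<Rightarrow> (real \<Rightarrow> 'a measure) \<Rightarrow> (real \<Rightarrow> 'a \<Rightarrow> real ^ 'w) \<Rightarrow> real \<Rightarrow>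
     (real \<Rightarrow> real ^ 'x \<Rightarrow> real) \<Rightarrow> (real ^ 'x \<Rightarrow> real) \<Rightarrow> (real \<Rightarrow> 'a \<Rightarrow> real ^ 'x) \<Rightarrow>
     (real \<Rightarrow> real ^ 'x \<Rightarrow> real ^ 'w) \<Rightarrow> real \<Rightarrow> 'a \<Rightarrow> real" where
  "y_proc M Fil W T g \<phi> X z t \<omega> =
     \<phi> (X T \<omega>) + (LINT r:{t..T}|lborel. g r (X r \<omega>))
     - ito_integral M Fil W t T (\<lambda>r \<omega>. z r (X r \<omega>)) T \<omega>"

definition y_DB_proc ::
    "'a measure \<Rightarrow> (real \<Rightarrow> 'a measure) \<Rightarrow> (real \<Rightarrow> 'a \<Rightarrow> real ^ 'w) \<Rightarrow> real \<Rightarrow>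
     (real \<Rightarrow> real ^ 'x \<Rightarrow> real) \<Rightarrow> (real \<Rightarrow> 'a \<Rightarrow> real ^ 'x) \<Rightarrow>
     real \<Rightarrow> (real \<Rightarrow> real ^ 'x \<Rightarrow> real ^ 'w) \<Rightarrow> real \<Rightarrow> 'a \<Rightarrow> real" where
  "y_DB_proc M Fil W T g X y0 z t \<omega> =
     y0 - (LINT r:{0..t}|lborel. g r (X r \<omega>))
     + ito_integral M Fil W 0 T (\<lambda>r \<omega>. z r (X r \<omega>)) t \<omega>"

text \<open>
  The mean squares are taken in \<open>[0, \<infinity>]\<close>, so that a random variable without second moment has
  mean square \<open>\<infinity>\<close>.
\<close>

definition DB_loss ::
    "'a measure \<Rightarrow> (real \<Rightarrow> 'a measure) \<Rightarrow> (real \<Rightarrow> 'a \<Rightarrow> real ^ 'w) \<Rightarrow> real \<Rightarrow>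
     (real \<Rightarrow> real ^ 'x \<Rightarrow> real) \<Rightarrow> (real ^ 'x \<Rightarrow> real) \<Rightarrow> (real \<Rightarrow> 'a \<Rightarrow> real ^ 'x) \<Rightarrow>
     real \<Rightarrow> (real \<Rightarrow> real ^ 'x \<Rightarrow> real ^ 'w) \<Rightarrow> ennreal" where
  "DB_loss M Fil W T g \<phi> X y0 z =
     (\<integral>\<^sup>+\<omega>. ennreal (\<bar>y_DB_proc M Fil W T g X y0 z T \<omega> - \<phi> (X T \<omega>)\<bar>\<^sup>2) \<partial>M)"

definition var_loss ::
    "'a measure \<Rightarrow> (real \<Rightarrow> 'a measure) \<Rightarrow> (real \<Rightarrow> 'a \<Rightarrow> real ^ 'w) \<Rightarrow> real \<Rightarrow>
     (real \<Rightarrow> real ^ 'x \<Rightarrow> real) \<Rightarrow> (real ^ 'x \<Rightarrow> real) \<Rightarrow> (real \<Rightarrow> 'a \<Rightarrow> real ^ 'x) \<Rightarrow>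
     (real \<Rightarrow> real ^ 'x \<Rightarrow> real ^ 'w) \<Rightarrow> ennreal" where
  "var_loss M Fil W T g \<phi> X z =
     (\<integral>\<^sup>+\<omega>. ennreal (\<bar>y_proc M Fil W T g \<phi> X z 0 \<omega>
        - prob_space.expectation M (y_proc M Fil W T g \<phi> X z 0)\<bar>\<^sup>2) \<partial>M)"

end

theory Submission
  imports Defs
begin

text \<open>
  The stochastic integral over \<open>[0, T]\<close> enters the forward process \<open>y_DB_proc\<close> at time \<open>T\<close> and the
  backward process \<open>y_proc\<close> at time \<open>0\<close> with opposite signs, and so does the running cost. Hence the
  terminal mismatch of the former is \<open>y - Y\<close>, pathwise, where \<open>Y = y_proc \<dots> 0\<close> does not depend on
  the initial guess \<open>y\<close> (\<open>DB_loss_eq_mean_square\<close>). For a fixed \<open>\<theta>\<close> the problem is to approximate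
  \<open>Y\<close> by a constant in mean square. The best constant is the mean of \<open>Y\<close> and the remaining error is
  the variance (\<open>mean_square_deviation_ge_variance\<close>). Minimizing over \<open>y\<close> first therefore turns the
  first loss into the second one, and both the infima and the minimizers correspond.

  The losses take values in \<open>[0, \<infinity>]\<close>. If \<open>Y\<close> has no second moment then both are infinite,
  whatever value the mean has, so it suffices that \<open>Y\<close> is measurable. For the cost this is
  part of the value function being well defined, applied to the solution \<open>X\<close>; for the stochastic
  integral it follows from adaptedness.
\<close>

text \<open>
  The cross term of \<open>(y - Y)\<^sup>2 = (Y - m)\<^sup>2 + 2 (m - y) (Y - m) + (m - y)\<^sup>2\<close> has mean zero if \<open>m\<close> is the
  mean of \<open>Y\<close>. The right-hand side is finite only if \<open>Y\<close> is square integrable, hence integrable, so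
  the expansion is available whenever there is something to prove.
\<close>

lemma (in prob_space) mean_square_deviation_ge_variance:
  fixes Y :: "'a \<Rightarrow> real"
  assumes Y[measurable]: "Y \<in> borel_measurable M"
  shows "(\<integral>\<^sup>+\<omega>. ennreal (\<bar>Y \<omega> - expectation Y\<bar>\<^sup>2) \<partial>M) \<le> (\<integral>\<^sup>+\<omega>. ennreal (\<bar>y - Y \<omega>\<bar>\<^sup>2) \<partial>M)"
proof (cases "(\<integral>\<^sup>+\<omega>. ennreal (\<bar>y - Y \<omega>\<bar>\<^sup>2) \<partial>M) = \<infinity>")
  case True
  then show ?thesis by simp
next
  case False
  define m where "m = expectation Y"
  have square: "integrable M (\<lambda>\<omega>. (y - Y \<omega>)\<^sup>2)"
    using False by (intro integrableI_nonneg) (auto simp: top.not_eq_extremum)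
  have "integrable M (\<lambda>\<omega>. y - Y \<omega>)"
    by (rule square_integrable_imp_integrable[OF _ square]) simp
  from Bochner_Integration.integrable_diff[OF integrable_const[of y] this]
  have Y_int: "integrable M Y" by simp
  have expand: "(Y \<omega> - m)\<^sup>2 = (y - Y \<omega>)\<^sup>2 - (2 * (m - y) * (Y \<omega> - m) + (m - y)\<^sup>2)" for \<omega>
    by (simp add: power2_eq_square algebra_simps)
  have centred: "integrable M (\<lambda>\<omega>. 2 * (m - y) * (Y \<omega> - m) + (m - y)\<^sup>2)"
    using Y_int by simp
  have var_int: "integrable M (\<lambda>\<omega>. (Y \<omega> - m)\<^sup>2)"
    unfolding expand using square centred by (rule Bochner_Integration.integrable_diff)
  have "expectation (\<lambda>\<omega>. 2 * (m - y) * (Y \<omega> - m) + (m - y)\<^sup>2) = (m - y)\<^sup>2"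
    using Y_int by (simp add: m_def prob_space)
  then have "expectation (\<lambda>\<omega>. (Y \<omega> - m)\<^sup>2) = expectation (\<lambda>\<omega>. (y - Y \<omega>)\<^sup>2) - (m - y)\<^sup>2"
    unfolding expand using square centred by simp
  then have "expectation (\<lambda>\<omega>. (Y \<omega> - m)\<^sup>2) \<le> expectation (\<lambda>\<omega>. (y - Y \<omega>)\<^sup>2)"
    by simp
  then show ?thesis
    using square var_int by (simp add: nn_integral_eq_integral m_def ennreal_leI)
qed

lemma (in brownian_basis) filtration_subset:
  assumes "t \<in> {0..T}"
  shows "sets (Fil t) \<subseteq> sets M"
proof -
  have generators: "null_sets M \<union> {W s -` A \<inter> space M | s A. 0 \<le> s \<and> s \<le> t \<and> A \<in> sets borel} \<subseteq> sets M"
    using assms W_measurable by (force intro: measurable_sets)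
  then have "sets (augmented_filtration M W t) \<subseteq> sets M"
    unfolding augmented_filtration_def
    by (subst sets_measure_of) (auto dest: sets.sets_into_space intro!: sets.sigma_sets_subset)
  then show ?thesis
    by (simp only: natural[OF assms])
qed

text \<open>
  The version picked by \<open>ito_integral\<close> is adapted, and where there is none the operator falls back
  to the constant \<open>0\<close>; both are measurable.
\<close>

lemma (in brownian_basis) borel_measurable_ito_integral:
  assumes "0 \<le> s" "t \<in> {s..T}"
  shows "ito_integral M Fil W s T \<xi> t \<in> borel_measurable M"
proof (cases "\<exists>I. has_ito_integral M Fil W s T \<xi> I")
  case True
  then have "has_ito_integral M Fil W s T \<xi> (ito_integral M Fil W s T \<xi>)"
    unfolding ito_integral_def by (simp add: someI_ex)
  then have "ito_integral M Fil W s T \<xi> t \<in> borel_measurable (Fil t)"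
    using assms by (simp add: has_ito_integral_def)
  moreover have t: "t \<in> {0..T}" using assms by simp
  have "space (Fil t) = space M"
    using sets_eq_imp_space_eq[OF natural[OF t]]
    by (simp add: augmented_filtration_def space_measure_of_conv)
  ultimately show ?thesis
    using filtration_subset[OF t] by (auto simp: measurable_def)
next
  case False
  then show ?thesis by (simp add: ito_integral_def)
qed

lemma DB_loss_eq_mean_square:
  "DB_loss M Fil W T g \<phi> X y z = (\<integral>\<^sup>+\<omega>. ennreal (\<bar>y - y_proc M Fil W T g \<phi> X z 0 \<omega>\<bar>\<^sup>2) \<partial>M)"
  by (simp add: DB_loss_def y_DB_proc_def y_proc_def algebra_simps)

lemma DB_loss_expectation:
  "DB_loss M Fil W T g \<phi> X (prob_space.expectation M (y_proc M Fil W T g \<phi> X z 0)) z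
     = var_loss M Fil W T g \<phi> X z"
  by (simp add: DB_loss_eq_mean_square var_loss_def abs_minus_commute)

lemma (in brownian_basis) var_loss_le_DB_loss:
  assumes "is_value_function M Fil W T b S g \<phi> v" and "sde_solution M Fil W T b S 0 x0 X"
  shows "var_loss M Fil W T g \<phi> X z \<le> DB_loss M Fil W T g \<phi> X y z"
proof -
  have "integrable M (\<lambda>\<omega>. \<phi> (X T \<omega>) + (LINT r:{0..T}|lborel. g r (X r \<omega>)))"
    using assms T_pos unfolding is_value_function_def by force
  then have "(\<lambda>\<omega>. \<phi> (X T \<omega>) + (LINT r:{0..T}|lborel. g r (X r \<omega>))) \<in> borel_measurable M"
    by (rule borel_measurable_integrable)
  moreover have "ito_integral M Fil W 0 T (\<lambda>r \<omega>. z r (X r \<omega>)) T \<in> borel_measurable M"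
    using T_pos by (intro borel_measurable_ito_integral) auto
  ultimately have "y_proc M Fil W T g \<phi> X z 0 \<in> borel_measurable M"
    unfolding y_proc_def by (rule borel_measurable_diff)
  then show ?thesis
    unfolding var_loss_def DB_loss_eq_mean_square by (rule mean_square_deviation_ge_variance)
qed

text \<open>
  Minimizing a loss in two variables can be done one variable at a time: \<open>h \<theta>\<close> is the minimum of
  \<open>f y \<theta>\<close> over \<open>y\<close>, attained at \<open>y = m \<theta>\<close>. The infima agree even if the outer minimum over \<open>\<theta>\<close>
  is not attained.
\<close>

lemma INF_partial_minimization:
  fixes f :: "'y \<Rightarrow> 'p \<Rightarrow> 'c::complete_linorder"
  assumes le: "\<And>y \<theta>. \<theta> \<in> \<Theta> \<Longrightarrow> h \<theta> \<le> f y \<theta>" and eq: "\<And>\<theta>. \<theta> \<in> \<Theta> \<Longrightarrow> f (m \<theta>) \<theta> = h \<theta>"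
  shows "(INF (y, \<theta>)\<in>UNIV \<times> \<Theta>. f y \<theta>) = (INF \<theta>\<in>\<Theta>. h \<theta>)"
proof (rule antisym)
  show "(INF (y, \<theta>)\<in>UNIV \<times> \<Theta>. f y \<theta>) \<le> (INF \<theta>\<in>\<Theta>. h \<theta>)"
  proof (rule INF_greatest)
    fix \<theta> assume "\<theta> \<in> \<Theta>"
    then show "(INF (y, \<theta>)\<in>UNIV \<times> \<Theta>. f y \<theta>) \<le> h \<theta>"
      using eq by (intro INF_lower2[of "(m \<theta>, \<theta>)"]) auto
  qed
  show "(INF \<theta>\<in>\<Theta>. h \<theta>) \<le> (INF (y, \<theta>)\<in>UNIV \<times> \<Theta>. f y \<theta>)"
    using le by (fastforce intro: INF_greatest INF_lower2)
qed

lemma is_arg_min_partial_minimization: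
  fixes f :: "'y \<Rightarrow> 'p \<Rightarrow> 'c::linorder"
  assumes le: "\<And>y \<theta>. \<theta> \<in> \<Theta> \<Longrightarrow> h \<theta> \<le> f y \<theta>" and eq: "\<And>\<theta>. \<theta> \<in> \<Theta> \<Longrightarrow> f (m \<theta>) \<theta> = h \<theta>"
  shows "is_arg_min (\<lambda>(y, \<theta>). f y \<theta>) (\<lambda>(y, \<theta>). \<theta> \<in> \<Theta>) (ystar, \<theta>star)
           \<Longrightarrow> is_arg_min h (\<lambda>\<theta>. \<theta> \<in> \<Theta>) \<theta>star"
    and "is_arg_min h (\<lambda>\<theta>. \<theta> \<in> \<Theta>) \<theta>star
           \<Longrightarrow> is_arg_min (\<lambda>(y, \<theta>). f y \<theta>) (\<lambda>(y, \<theta>). \<theta> \<in> \<Theta>) (m \<theta>star, \<theta>star)"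
proof -
  assume "is_arg_min (\<lambda>(y, \<theta>). f y \<theta>) (\<lambda>(y, \<theta>). \<theta> \<in> \<Theta>) (ystar, \<theta>star)"
  then have star: "\<theta>star \<in> \<Theta>" and min: "\<And>y \<theta>. \<theta> \<in> \<Theta> \<Longrightarrow> f ystar \<theta>star \<le> f y \<theta>"
    by (auto simp: is_arg_min_linorder)
  have "h \<theta>star \<le> h \<theta>" if "\<theta> \<in> \<Theta>" for \<theta>
    using le[OF star, of ystar] min[OF that, of "m \<theta>"] eq[OF that] by simp
  with star show "is_arg_min h (\<lambda>\<theta>. \<theta> \<in> \<Theta>) \<theta>star"
    by (auto simp: is_arg_min_linorder)
next
  assume "is_arg_min h (\<lambda>\<theta>. \<theta> \<in> \<Theta>) \<theta>star"
  then show "is_arg_min (\<lambda>(y, \<theta>). f y \<theta>) (\<lambda>(y, \<theta>). \<theta> \<in> \<Theta>) (m \<theta>star, \<theta>star)"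
    using le eq by (auto simp: is_arg_min_linorder intro: order_trans)
qed

theorem theorem2:
  fixes M :: "'a measure" and Fil :: "real \<Rightarrow> 'a measure"
    and W :: "real \<Rightarrow> 'a \<Rightarrow> real ^ 'w" and T :: real
    and F :: "real \<Rightarrow> real ^ 'x \<Rightarrow> real ^ 'x"
    and G :: "real \<Rightarrow> real ^ 'x \<Rightarrow> real ^ 'u ^ 'x"
    and \<sigma> :: "real \<Rightarrow> real ^ 'x \<Rightarrow> real ^ 'w ^ 'x"
    and Q :: "real \<Rightarrow> real ^ 'x \<Rightarrow> real"
    and R :: "real \<Rightarrow> real ^ 'x \<Rightarrow> real ^ 'u ^ 'u"
    and \<phi> :: "real ^ 'x \<Rightarrow> real"
    and u :: "real \<Rightarrow> real ^ 'x \<Rightarrow> real ^ 'u"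
    and g :: "real \<Rightarrow> real ^ 'x \<Rightarrow> real"
    and b :: "real \<Rightarrow> real ^ 'x \<Rightarrow> real ^ 'x"
    and v :: "real \<Rightarrow> real ^ 'x \<Rightarrow> real"
    and x0 :: "real ^ 'x"
    and X :: "real \<Rightarrow> 'a \<Rightarrow> real ^ 'x"
    and \<Theta> :: "'p set"
    and z :: "'p \<Rightarrow> real \<Rightarrow> real ^ 'x \<Rightarrow> real ^ 'w"
  defines "g \<equiv> running_cost Q R u"
    and "b \<equiv> controlled_drift F G u"
  assumes "brownian_basis M Fil W T"
    and "\<And>t x. t \<in> {0..T} \<Longrightarrow> positive_definite (R t x)"
    and "is_value_function M Fil W T b \<sigma> g \<phi> v"
    and "satisfies_value_pde T b \<sigma> g \<phi> v"
    and "C12 T v"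
    and "unique_strong_solution M Fil W T b \<sigma> 0 x0 X"
    and "\<And>\<theta>. \<theta> \<in> \<Theta> \<Longrightarrow> L2_process M Fil T (\<lambda>t \<omega>. z \<theta> t (X t \<omega>))"
  shows "(INF (y, \<theta>)\<in>UNIV \<times> \<Theta>. DB_loss M Fil W T g \<phi> X y (z \<theta>))
           = (INF \<theta>\<in>\<Theta>. var_loss M Fil W T g \<phi> X (z \<theta>))
       \<and> (\<forall>ystar \<theta>star.
            is_arg_min (\<lambda>(y, \<theta>). DB_loss M Fil W T g \<phi> X y (z \<theta>)) (\<lambda>(y, \<theta>). \<theta> \<in> \<Theta>) (ystar, \<theta>star)
            \<longrightarrow> is_arg_min (\<lambda>\<theta>. var_loss M Fil W T g \<phi> X (z \<theta>)) (\<lambda>\<theta>. \<theta> \<in> \<Theta>) \<theta>star)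
       \<and> (\<forall>\<theta>star.
            is_arg_min (\<lambda>\<theta>. var_loss M Fil W T g \<phi> X (z \<theta>)) (\<lambda>\<theta>. \<theta> \<in> \<Theta>) \<theta>star
            \<longrightarrow> (\<exists>ystar.
                  is_arg_min (\<lambda>(y, \<theta>). DB_loss M Fil W T g \<phi> X y (z \<theta>)) (\<lambda>(y, \<theta>). \<theta> \<in> \<Theta>)
                    (ystar, \<theta>star)))"
proof -
  interpret brownian_basis M Fil W T by fact
  let ?Y = "\<lambda>\<theta>. y_proc M Fil W T g \<phi> X (z \<theta>) 0"
  have le: "var_loss M Fil W T g \<phi> X (z \<theta>) \<le> DB_loss M Fil W T g \<phi> X y (z \<theta>)" for y \<theta>
    using assms(5,8) unfolding unique_strong_solution_def by (blast intro: var_loss_le_DB_loss)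
  have eq: "DB_loss M Fil W T g \<phi> X (expectation (?Y \<theta>)) (z \<theta>) = var_loss M Fil W T g \<phi> X (z \<theta>)" for \<theta>
    by (rule DB_loss_expectation)
  note partial = INF_partial_minimization is_arg_min_partial_minimization
  note partial = partial[where m = "\<lambda>\<theta>. expectation (?Y \<theta>)" and \<Theta> = \<Theta>
      and h = "\<lambda>\<theta>. var_loss M Fil W T g \<phi> X (z \<theta>)"
      and f = "\<lambda>y \<theta>. DB_loss M Fil W T g \<phi> X y (z \<theta>)", OF le eq]
  show ?thesis
    using partial by blast
qed

end
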